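(* Let $X,Y,Z$ be $\sigma$-sets, and consider $E_X=\overrightarrow{XYZ}\cup\overrightarrow{Z^{\ast}Y^{\ast}X^{\ast}}$, $E_Y=\overrightarrow{YZX}\cup\overrightarrow{X^{\ast}Z^{\ast}Y^{\ast}}$, $E_Z=\overrightarrow{ZXY}\cup\overrightarrow{Y^{\ast}X^{\ast}Z^{\ast}}$. If $E=\{E_X,E_Y,E_Z\}=\{\emptyset\}$, i.e. $E_X=E_Y=E_Z=\emptyset$, then fusion is locally associative on $X,Y,Z$.
   Context: A $\sigma$-set is a collection whose members may be elements or antielements. Every element $x$ has an antielement $x^{\ast}$, with $(x^{\ast})^{\ast}=x$. For a $\sigma$-set $A$, $A^{\ast}=\{a^{\ast}: a\in A\}$. For $\sigma$-sets $P,Q$ define $P \hat{\cap} Q := \{p \in P : p^{\ast} \in Q\}$ and $P \divideontimes Q := P - (P \hat{\cap} Q)$. The fusion of $P$ and $Q$, written $P \cup Q$ (not ordinary union), is $P \cup Q = \{p : p \in P \divideontimes Q \text{ or } p \in Q \divideontimes P\}$. For $\sigma$-sets $P,Q,R$, the chain of fusion $\overrightarrow{PQR}$ denotes $(P\cup Q)\cup R$. Such a chain is associative if $(P\cup Q)\cup R=P\cup(Q\cup R)$. Three $\sigma$-sets $X,Y,Z$ are locally associative over fusion if, for every ordering $P,Q,R$ of $X,Y,Z$, the fusion chain $\overrightarrow{PQR}$ is associative. *)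

theory Defs
  imports "HOL-Library.Multiset"
begin

text \<open>
  A type of this class is a universe of elements and antielements; \<open>anti x\<close> is the
  antielement of \<open>x\<close>, so that an element and its antielement are each other's antielements.
  A \<open>\<sigma>\<close>-set is an arbitrary set over such a universe; it is not required that
  \<open>x\<close> and \<open>anti x\<close> exclude each other.
\<close>

class antielement =
  fixes anti :: "'a \<Rightarrow> 'a"
  assumes anti_anti: "anti (anti x) = x"

type_synonym 'a sigma_set = "'a set"

definition anti_set :: "'a::antielement sigma_set \<Rightarrow> 'a sigma_set" where
  "anti_set A = {anti a | a. a \<in> A}"

definition hat_inter :: "'a::antielement sigma_set \<Rightarrow> 'a sigma_set \<Rightarrow> 'a sigma_set" where
  "hat_inter P Q = {p \<in> P. anti p \<in> Q}"

definition star_diff :: "'a::antielement sigma_set \<Rightarrow> 'a sigma_set \<Rightarrow> 'a sigma_set" where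
  "star_diff P Q = P - hat_inter P Q"

definition fusion :: "'a::antielement sigma_set \<Rightarrow> 'a sigma_set \<Rightarrow> 'a sigma_set" where
  "fusion P Q = {p. p \<in> star_diff P Q \<or> p \<in> star_diff Q P}"

definition fusion_chain ::
  "'a::antielement sigma_set \<Rightarrow> 'a sigma_set \<Rightarrow> 'a sigma_set \<Rightarrow> 'a sigma_set" where
  "fusion_chain P Q R = fusion (fusion P Q) R"

definition chain_associative ::
  "'a::antielement sigma_set \<Rightarrow> 'a sigma_set \<Rightarrow> 'a sigma_set \<Rightarrow> bool" where
  "chain_associative P Q R \<longleftrightarrow> fusion (fusion P Q) R = fusion P (fusion Q R)"

text \<open>The multiset equation says that \<open>P, Q, R\<close> is a reordering of \<open>X, Y, Z\<close>,
  also when some of \<open>X, Y, Z\<close> coincide.\<close>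

definition locally_associative ::
  "'a::antielement sigma_set \<Rightarrow> 'a sigma_set \<Rightarrow> 'a sigma_set \<Rightarrow> bool" where
  "locally_associative X Y Z \<longleftrightarrow>
    (\<forall>P Q R. {#P, Q, R#} = {#X, Y, Z#} \<longrightarrow> chain_associative P Q R)"

end

theory Submission
  imports Defs
begin

text \<open>
  A fusion \<open>A \<union> B\<close> is empty only if \<open>B = A\<^sup>*\<close>. As \<open>*\<close> is an involution that distributes over
  the commutative operation of fusion, \<open>E\<^sub>X = \<emptyset>\<close> says that
  \<open>(X \<union> Y) \<union> Z = (Z \<union> Y) \<union> X = X \<union> (Y \<union> Z)\<close>. This covers the orderings \<open>XYZ\<close> and \<open>ZYX\<close>,
  and \<open>E\<^sub>Y\<close>, \<open>E\<^sub>Z\<close> cover the other four.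
\<close>

lemma fusion_commute: "fusion P Q = fusion Q P"
  by (auto simp: fusion_def)

lemma mem_fusion_iff:
  "p \<in> fusion P Q \<longleftrightarrow> p \<in> P \<and> anti p \<notin> Q \<or> p \<in> Q \<and> anti p \<notin> P"
  by (auto simp: fusion_def star_diff_def hat_inter_def)

lemma mem_anti_set_iff: "p \<in> anti_set A \<longleftrightarrow> anti p \<in> A"
  unfolding anti_set_def by (auto simp: anti_anti) (metis anti_anti)

lemma anti_set_anti_set: "anti_set (anti_set A) = A"
  by (auto simp: mem_anti_set_iff anti_anti)

lemma anti_set_fusion: "anti_set (fusion P Q) = fusion (anti_set P) (anti_set Q)"
  by (auto simp: mem_anti_set_iff mem_fusion_iff)

text \<open>A point \<open>p\<close> of \<open>B\<close> stays out of the fusion only if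
  \<open>anti p\<close> lies in \<open>A\<close>; conversely, \<open>anti p\<close> in
  \<open>A\<close> stays out only if \<open>p\<close> lies in \<open>B\<close>. Hence emptiness is
  used at both \<open>p\<close> and \<open>anti p\<close>.\<close>

lemma fusion_empty_imp_anti_set:
  assumes "fusion A B = {}"
  shows "B = anti_set A"
proof (rule set_eqI)
  fix p
  have "p \<notin> fusion A B" and "anti p \<notin> fusion A B"
    using assms by auto
  then show "p \<in> B \<longleftrightarrow> p \<in> anti_set A"
    by (auto simp: mem_fusion_iff mem_anti_set_iff anti_anti)
qed

lemma fusion_chain_anti_empty_imp_associative:
  assumes "fusion (fusion_chain P Q R)
             (fusion_chain (anti_set R) (anti_set Q) (anti_set P)) = {}"
  shows "chain_associative P Q R" and "chain_associative R Q P"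
proof -
  have "anti_set (fusion_chain R Q P) = anti_set (fusion_chain P Q R)"
    using fusion_empty_imp_anti_set[OF assms] by (simp add: fusion_chain_def anti_set_fusion)
  then have "fusion_chain R Q P = fusion_chain P Q R"
    by (metis anti_set_anti_set)
  \<comment> \<open>Commuting both fusions turns the chain \<open>R Q P\<close> into the
    right-bracketed \<open>P Q R\<close>, and vice versa, so one equation gives both claims.\<close>
  then show "chain_associative P Q R" and "chain_associative R Q P"
    by (simp_all add: fusion_chain_def chain_associative_def) (metis fusion_commute)+
qed

theorem theorem3p8:
  fixes X Y Z :: "'a::antielement sigma_set"
  assumes "{fusion (fusion_chain X Y Z) (fusion_chain (anti_set Z) (anti_set Y) (anti_set X)),
            fusion (fusion_chain Y Z X) (fusion_chain (anti_set X) (anti_set Z) (anti_set Y)),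
            fusion (fusion_chain Z X Y) (fusion_chain (anti_set Y) (anti_set X) (anti_set Z))}
           = {{}}"
  shows "locally_associative X Y Z"
proof -
  have
    "fusion (fusion_chain X Y Z) (fusion_chain (anti_set Z) (anti_set Y) (anti_set X)) = {}"
    "fusion (fusion_chain Y Z X) (fusion_chain (anti_set X) (anti_set Z) (anti_set Y)) = {}"
    "fusion (fusion_chain Z X Y) (fusion_chain (anti_set Y) (anti_set X) (anti_set Z)) = {}"
    using assms by blast+
  \<comment> \<open>Part (1) yields the three cyclic orderings, part (2) their reversals.\<close>
  note assoc = this[THEN fusion_chain_anti_empty_imp_associative(1)]
    this[THEN fusion_chain_anti_empty_imp_associative(2)]
  show ?thesis
    unfolding locally_associative_def
  proof (intro allI impI)
    fix P Q R
    assume "{#P, Q, R#} = {#X, Y, Z#}"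
    then have "(P, Q, R) \<in> {(X, Y, Z), (X, Z, Y), (Y, X, Z), (Y, Z, X), (Z, X, Y), (Z, Y, X)}"
      by (auto simp: add_eq_conv_ex)
    then show "chain_associative P Q R"
      using assoc by auto
  qed
qed

end
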